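(* Let $(\Phi,\{\Pi_\varphi\}_{\varphi\in\Phi})$ be a t-stability on a triangulated category $\mathcal{T}$, with $\tau\in\mathrm{Aut}(\Phi)$ the automorphism corresponding to the shift of $\mathcal{T}$. Suppose $\Phi=\Phi_-\sqcup\Phi_+$ is a decomposition into two disjoint parts such that $\varphi_-<\varphi_+$ for all $\varphi_-\in\Phi_-$ and $\varphi_+\in\Phi_+$. Then the pair of subcategories $$\mathcal{T}^{\ge0}=\langle\Pi_\varphi\mid\varphi\in\tau(\Phi_-)\rangle,\qquad \mathcal{T}^{\le0}=\langle\Pi_\varphi\mid\varphi\in\Phi_+\rangle$$ defines a t-structure on $\mathcal{T}$.
   Context: Write $\mathrm{Hom}^i(X,Y)=\mathrm{Hom}_{\mathcal{T}}(X,Y[i])$; $\mathrm{Hom}^{\le 0}(\mathcal{X},\mathcal{Y})=0$ means $\mathrm{Hom}^i(X,Y)=0$ for all $i\le 0$, $X\in\mathcal{X}$, $Y\in\mathcal{Y}$. A subcategory $\mathcal{X}$ is extension-closed if for every distinguished triangle $A\to B\to C\to A[1]$ with $A,C\in\mathcal{X}$ also $B\in\mathcal{X}$. $\langle S\rangle$ denotes the smallest strictly full extension-closed subcategory containing $S$ (and zero objects). A t-stability on $\mathcal{T}$ is a pair $(\Phi,\{\Pi_\varphi\}_{\varphi\in\Phi})$, where $\Phi$ is a linearly ordered set and each $\Pi_\varphi\subset\mathcal{T}$ is a nonempty, strictly full (full and closed under isomorphisms), extension-closed subcategory, such that: (1) there is an automorphism $\tau$ of the ordered set $\Phi$ with $\Pi_\varphi[1]=\Pi_{\tau(\varphi)}$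 and $\tau(\varphi)\ge\varphi$ for all $\varphi$; (2) $\mathrm{Hom}^{\le 0}(\Pi_\psi,\Pi_\varphi)=0$ whenever $\psi>\varphi$; (3) every nonzero $X\in\mathcal{T}$ has a finite system of distinguished triangles $F^{i+1}X\to F^iX\to X_{\varphi_i}\to F^{i+1}X[1]$, $0\le i\le n$, with $F^0X=X$, $F^{n+1}X=0$, $0\ne X_{\varphi_i}\in\Pi_{\varphi_i}$ and $\varphi_0<\dots<\varphi_n$. A t-structure on $\mathcal{T}$ is a pair $(D^{\le0},D^{\ge0})$ of strictly full subcategories with $D^{\le0}\subset D^{\le0}[-1]$, $D^{\ge0}\supset D^{\ge0}[-1]$; $\mathrm{Hom}^0(D^{\le0},D^{\ge0}[-1])=0$; and every $X\in\mathcal{T}$ fits into a distinguished triangle $X_{\le0}\to X\to X_{\ge1}\to X_{\le0}[1]$ with $X_{\le0}\in D^{\le0}$, $X_{\ge1}\in D^{\ge0}[-1]$. *)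

theory Defs
  imports "HOL-Algebra.Group"
begin

section \<open>Triangulated categories\<close>

text \<open>
  \<open>Comp C g f\<close> is \<open>g\<close> after \<open>f\<close>; it is only meaningful when \<open>Cod C f = Dom C g\<close>.
  \<open>Plus\<close> is only meaningful on parallel morphisms, and \<open>Zero C A B\<close> is the zero morphism
  from \<open>A\<close> to \<open>B\<close>.  The shift \<open>X \<mapsto> X[1]\<close> is given by \<open>ShO\<close> on objects and \<open>ShM\<close> on morphisms.
  A triple \<open>(u, v, w)\<close> in \<open>Dist\<close> stands for the distinguished triangle
  \<open>X \<rightarrow> Y \<rightarrow> Z \<rightarrow> X[1]\<close>, whose objects are determined by \<open>u\<close> and \<open>v\<close>.
\<close>

record ('o, 'm) cat =
  Obj :: "'o set"
  Mor :: "'m set"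
  Dom :: "'m \<Rightarrow> 'o"
  Cod :: "'m \<Rightarrow> 'o"
  Id :: "'o \<Rightarrow> 'm"
  Comp :: "'m \<Rightarrow> 'm \<Rightarrow> 'm"  (infixl "\<cdot>\<index>" 70)

record ('o, 'm) additive_cat = "('o, 'm) cat" +
  Plus :: "'m \<Rightarrow> 'm \<Rightarrow> 'm"
  Zero :: "'o \<Rightarrow> 'o \<Rightarrow> 'm"

record ('o, 'm) triang_cat = "('o, 'm) additive_cat" +
  ShO :: "'o \<Rightarrow> 'o"
  ShM :: "'m \<Rightarrow> 'm"
  Dist :: "('m \<times> 'm \<times> 'm) set"

definition Homs :: "('o, 'm, 'z) cat_scheme \<Rightarrow> 'o \<Rightarrow> 'o \<Rightarrow> 'm set" where
  "Homs C A B = {f \<in> Mor C. Dom C f = A \<and> Cod C f = B}"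

locale category =
  fixes C :: "('o, 'm, 'z) cat_scheme" (structure)
  assumes dom_obj: "f \<in> Mor C \<Longrightarrow> Dom C f \<in> Obj C"
    and cod_obj: "f \<in> Mor C \<Longrightarrow> Cod C f \<in> Obj C"
    and id_hom: "A \<in> Obj C \<Longrightarrow> Id C A \<in> Homs C A A"
    and comp_hom: "\<lbrakk>f \<in> Homs C A B; g \<in> Homs C B D\<rbrakk> \<Longrightarrow> g \<cdot> f \<in> Homs C A D"
    and id_right: "f \<in> Homs C A B \<Longrightarrow> f \<cdot> Id C A = f"
    and id_left: "f \<in> Homs C A B \<Longrightarrow> Id C B \<cdot> f = f"
    and comp_assoc: "\<lbrakk>f \<in> Homs C A B; g \<in> Homs C B D; h \<in> Homs C D E\<rbrakk>
      \<Longrightarrow> h \<cdot> (g \<cdot> f) = (h \<cdot> g) \<cdot> f"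

definition iso_arrow :: "('o, 'm, 'z) cat_scheme \<Rightarrow> 'o \<Rightarrow> 'o \<Rightarrow> 'm \<Rightarrow> bool" where
  "iso_arrow C A B f \<longleftrightarrow> f \<in> Homs C A B \<and>
     (\<exists>g \<in> Homs C B A. Comp C g f = Id C A \<and> Comp C f g = Id C B)"

definition iso_objects :: "('o, 'm, 'z) cat_scheme \<Rightarrow> 'o \<Rightarrow> 'o \<Rightarrow> bool" where
  "iso_objects C A B \<longleftrightarrow> (\<exists>f. iso_arrow C A B f)"

definition zero_object :: "('o, 'm, 'z) cat_scheme \<Rightarrow> 'o \<Rightarrow> bool" where
  "zero_object C Z \<longleftrightarrow> Z \<in> Obj C \<and>
     (\<forall>A \<in> Obj C. (\<exists>!f. f \<in> Homs C A Z) \<and> (\<exists>!f. f \<in> Homs C Z A))"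

definition hom_group :: "('o, 'm, 'z) additive_cat_scheme \<Rightarrow> 'o \<Rightarrow> 'o \<Rightarrow> 'm monoid" where
  "hom_group C A B = \<lparr>carrier = Homs C A B, monoid.mult = Plus C, one = Zero C A B\<rparr>"

definition Neg :: "('o, 'm, 'z) additive_cat_scheme \<Rightarrow> 'm \<Rightarrow> 'm" where
  "Neg C f = m_inv (hom_group C (Dom C f) (Cod C f)) f"

locale additive_category = category C
  for C :: "('o, 'm, 'z) additive_cat_scheme" (structure) +
  assumes hom_comm_group: "\<lbrakk>A \<in> Obj C; B \<in> Obj C\<rbrakk> \<Longrightarrow> comm_group (hom_group C A B)"
    and comp_plus_right: "\<lbrakk>f \<in> Homs C A B; f' \<in> Homs C A B; g \<in> Homs C B D\<rbrakk>
      \<Longrightarrow> g \<cdot> Plus C f f' = Plus C (g \<cdot> f) (g \<cdot> f')"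
    and comp_plus_left: "\<lbrakk>f \<in> Homs C A B; g \<in> Homs C B D; g' \<in> Homs C B D\<rbrakk>
      \<Longrightarrow> Plus C g g' \<cdot> f = Plus C (g \<cdot> f) (g' \<cdot> f)"
    and ex_zero_object: "\<exists>Z. zero_object C Z"
    and ex_biproduct: "\<lbrakk>A \<in> Obj C; B \<in> Obj C\<rbrakk> \<Longrightarrow>
      \<exists>S \<in> Obj C. \<exists>i \<in> Homs C A S. \<exists>j \<in> Homs C B S. \<exists>p \<in> Homs C S A. \<exists>q \<in> Homs C S B.
        p \<cdot> i = Id C A \<and> q \<cdot> j = Id C B \<and> q \<cdot> i = Zero C A B \<and> p \<cdot> j = Zero C B A \<and>
        Plus C (i \<cdot> p) (j \<cdot> q) = Id C S"

definition dist_triangle ::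
    "('o, 'm, 'z) triang_cat_scheme \<Rightarrow> 'o \<Rightarrow> 'o \<Rightarrow> 'o \<Rightarrow> 'm \<Rightarrow> 'm \<Rightarrow> 'm \<Rightarrow> bool" where
  "dist_triangle T X Y Z u v w \<longleftrightarrow>
     u \<in> Homs T X Y \<and> v \<in> Homs T Y Z \<and> w \<in> Homs T Z (ShO T X) \<and> (u, v, w) \<in> Dist T"

text \<open>
  Verdier's axioms.  The shift is an automorphism (not merely an autoequivalence) of the
  additive category, as in Verdier and Gelfand--Manin; so \<open>X[-1]\<close> is an honest object
  and \<open>X[-1][1] = X\<close>.  Axiom \<open>octahedron\<close> is TR4.
\<close>

locale triangulated_category = additive_category T
  for T :: "('o, 'm, 'z) triang_cat_scheme" (structure) +
  assumes shift_obj_bij: "bij_betw (ShO T) (Obj T) (Obj T)"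
    and shift_mor_bij: "bij_betw (ShM T) (Mor T) (Mor T)"
    and shift_hom: "f \<in> Homs T A B \<Longrightarrow> ShM T f \<in> Homs T (ShO T A) (ShO T B)"
    and shift_id: "A \<in> Obj T \<Longrightarrow> ShM T (Id T A) = Id T (ShO T A)"
    and shift_comp: "\<lbrakk>f \<in> Homs T A B; g \<in> Homs T B D\<rbrakk> \<Longrightarrow> ShM T (g \<cdot> f) = ShM T g \<cdot> ShM T f"
    and shift_plus: "\<lbrakk>f \<in> Homs T A B; g \<in> Homs T A B\<rbrakk>
      \<Longrightarrow> ShM T (Plus T f g) = Plus T (ShM T f) (ShM T g)"
    and dist_typed: "(u, v, w) \<in> Dist T \<Longrightarrow> \<exists>X Y Z. dist_triangle T X Y Z u v w"
    and dist_id: "\<lbrakk>X \<in> Obj T; zero_object T Z\<rbrakk>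
      \<Longrightarrow> dist_triangle T X X Z (Id T X) (Zero T X Z) (Zero T Z (ShO T X))"
    and dist_iso:
      "\<lbrakk>dist_triangle T X Y Z u v w;
        u' \<in> Homs T X' Y'; v' \<in> Homs T Y' Z'; w' \<in> Homs T Z' (ShO T X');
        iso_arrow T X X' f; iso_arrow T Y Y' g; iso_arrow T Z Z' h;
        u' \<cdot> f = g \<cdot> u; v' \<cdot> g = h \<cdot> v; w' \<cdot> h = ShM T f \<cdot> w\<rbrakk>
       \<Longrightarrow> dist_triangle T X' Y' Z' u' v' w'"
    and dist_extend: "u \<in> Homs T X Y \<Longrightarrow> \<exists>Z v w. dist_triangle T X Y Z u v w"
    and dist_rotate: "\<lbrakk>u \<in> Homs T X Y; v \<in> Homs T Y Z; w \<in> Homs T Z (ShO T X)\<rbrakk>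
      \<Longrightarrow> dist_triangle T X Y Z u v w \<longleftrightarrow> dist_triangle T Y Z (ShO T X) v w (Neg T (ShM T u))"
    and dist_morphism:
      "\<lbrakk>dist_triangle T X Y Z u v w; dist_triangle T X' Y' Z' u' v' w';
        f \<in> Homs T X X'; g \<in> Homs T Y Y'; u' \<cdot> f = g \<cdot> u\<rbrakk>
       \<Longrightarrow> \<exists>h \<in> Homs T Z Z'. v' \<cdot> g = h \<cdot> v \<and> w' \<cdot> h = ShM T f \<cdot> w"
    and octahedron:
      "\<lbrakk>dist_triangle T X Y Z' u i i'; dist_triangle T Y Z X' v j j';
        dist_triangle T X Z Y' (v \<cdot> u) k k'\<rbrakk>
       \<Longrightarrow> \<exists>f g. dist_triangle T Z' Y' X' f g (ShM T i \<cdot> j') \<and>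
             k \<cdot> v = f \<cdot> i \<and> k' \<cdot> f = i' \<and> g \<cdot> k = j \<and> j' \<cdot> g = ShM T u \<cdot> k'"

text \<open>\<open>shift_ob T i X\<close> is \<open>X[i]\<close> for an arbitrary integer \<open>i\<close>.\<close>

definition shift_ob :: "('o, 'm, 'z) triang_cat_scheme \<Rightarrow> int \<Rightarrow> 'o \<Rightarrow> 'o" where
  "shift_ob T i X =
     (if 0 \<le> i then (ShO T ^^ nat i) X else (inv_into (Obj T) (ShO T) ^^ nat (- i)) X)"

section \<open>Full subcategories\<close>

text \<open>A full subcategory is represented by its set of objects, so \<open>P[i]\<close> is \<open>shift_ob T i ` P\<close>.\<close>

definition strictly_full :: "('o, 'm, 'z) cat_scheme \<Rightarrow> 'o set \<Rightarrow> bool" where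
  "strictly_full C P \<longleftrightarrow> P \<subseteq> Obj C \<and> (\<forall>A \<in> P. \<forall>B. iso_objects C A B \<longrightarrow> B \<in> P)"

definition extension_closed :: "('o, 'm, 'z) triang_cat_scheme \<Rightarrow> 'o set \<Rightarrow> bool" where
  "extension_closed T P \<longleftrightarrow>
     (\<forall>A B D u v w. dist_triangle T A B D u v w \<and> A \<in> P \<and> D \<in> P \<longrightarrow> B \<in> P)"

definition ext_hull :: "('o, 'm, 'z) triang_cat_scheme \<Rightarrow> 'o set \<Rightarrow> 'o set" where
  "ext_hull T S = \<Inter> {P. strictly_full T P \<and> extension_closed T P \<and> S \<subseteq> P \<and>
                          (\<forall>Z. zero_object T Z \<longrightarrow> Z \<in> P)}"

text \<open>\<open>Hom_vanish T i P Q\<close> says that \<open>Hom(X, Y[i]) = 0\<close> for all \<open>X \<in> P\<close> and \<open>Y \<in> Q\<close>.\<close>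

definition Hom_vanish ::
    "('o, 'm, 'z) triang_cat_scheme \<Rightarrow> int \<Rightarrow> 'o set \<Rightarrow> 'o set \<Rightarrow> bool" where
  "Hom_vanish T i P Q \<longleftrightarrow>
     (\<forall>X \<in> P. \<forall>Y \<in> Q. Homs T X (shift_ob T i Y) = {Zero T X (shift_ob T i Y)})"

section \<open>t-stabilities and t-structures\<close>

text \<open>
  The linearly ordered set is a subset \<open>\<Phi>\<close> of a linearly ordered type, with the induced
  order.  On a linear order a strictly monotone bijection is an order automorphism.
\<close>

definition shift_automorphism ::
    "('o, 'm, 'z) triang_cat_scheme \<Rightarrow> 'p::linorder set \<Rightarrow> ('p \<Rightarrow> 'o set) \<Rightarrow> ('p \<Rightarrow> 'p) \<Rightarrow> bool" where
  "shift_automorphism T \<Phi> \<P> \<tau> \<longleftrightarrow>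
     bij_betw \<tau> \<Phi> \<Phi> \<and> strict_mono_on \<Phi> \<tau> \<and>
     (\<forall>\<phi> \<in> \<Phi>. shift_ob T 1 ` \<P> \<phi> = \<P> (\<tau> \<phi>) \<and> \<phi> \<le> \<tau> \<phi>)"

definition t_stability ::
    "('o, 'm, 'z) triang_cat_scheme \<Rightarrow> 'p::linorder set \<Rightarrow> ('p \<Rightarrow> 'o set) \<Rightarrow> bool" where
  "t_stability T \<Phi> \<P> \<longleftrightarrow>
     (\<forall>\<phi> \<in> \<Phi>. \<P> \<phi> \<noteq> {} \<and> strictly_full T (\<P> \<phi>) \<and> extension_closed T (\<P> \<phi>)) \<and>
     (\<exists>\<tau>. shift_automorphism T \<Phi> \<P> \<tau>) \<and>
     (\<forall>\<phi> \<in> \<Phi>. \<forall>\<psi> \<in> \<Phi>. \<psi> > \<phi> \<longrightarrow> (\<forall>i \<le> 0. Hom_vanish T i (\<P> \<psi>) (\<P> \<phi>))) \<and>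
     (\<forall>X \<in> Obj T. \<not> zero_object T X \<longrightarrow>
        (\<exists>(n::nat) F G \<phi>.
           F 0 = X \<and> zero_object T (F (Suc n)) \<and>
           (\<forall>i \<le> n. \<phi> i \<in> \<Phi> \<and> G i \<in> \<P> (\<phi> i) \<and> \<not> zero_object T (G i) \<and>
                     (\<exists>u v w. dist_triangle T (F (Suc i)) (F i) (G i) u v w)) \<and>
           (\<forall>i < n. \<phi> i < \<phi> (Suc i))))"

definition t_structure ::
    "('o, 'm, 'z) triang_cat_scheme \<Rightarrow> 'o set \<Rightarrow> 'o set \<Rightarrow> bool" where
  "t_structure T Dle Dge \<longleftrightarrow>
     strictly_full T Dle \<and> strictly_full T Dge \<and>
     Dle \<subseteq> shift_ob T (- 1) ` Dle \<and> shift_ob T (- 1) ` Dge \<subseteq> Dge \<and>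
     Hom_vanish T 0 Dle (shift_ob T (- 1) ` Dge) \<and>
     (\<forall>X \<in> Obj T. \<exists>A \<in> Dle. \<exists>B \<in> shift_ob T (- 1) ` Dge. \<exists>u v w. dist_triangle T A X B u v w)"

end

theory Submission
  imports Defs
begin

text \<open>
  Write \<open>P\<^sub>+\<close> and \<open>P\<^sub>-\<close> for the unions of the slices indexed by \<open>\<Phi>\<^sub>+\<close> and \<open>\<Phi>\<^sub>-\<close>.  Rotating a
  triangle three times shifts it up to signs, so extension hulls commute with the shift
  (\<open>ext_hull_shift\<close>).  The coaisle of the claimed t-structure is therefore
  \<open>\<langle>P\<^sub>-[1]\<rangle> = \<langle>P\<^sub>-\<rangle>[1]\<close>, and its shift by \<open>-1\<close> is just \<open>\<langle>P\<^sub>-\<rangle>\<close>.  With this the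
  theorem is about the pair \<open>(\<langle>P\<^sub>+\<rangle>, \<langle>P\<^sub>-\<rangle>)\<close>.

  Because \<open>\<tau>\<close> moves phases upwards and \<open>\<Phi>\<^sub>+\<close> is an upper set, \<open>\<tau>\<close> maps \<open>\<Phi>\<^sub>+\<close> into itself, and
  \<open>\<Phi>\<^sub>-\<close> is contained in \<open>\<tau> \<Phi>\<^sub>-\<close>; this gives the two inclusions under the shift.

  Orthogonality holds between the slices.  The long exact sequences of \<open>Hom\<close> make both
  \<open>{X. Hom(X, Y) = 0}\<close> and \<open>{Y. Hom(X, Y) = 0}\<close> closed under extensions
  (\<open>left_orthogonal_ext_class\<close>, \<open>right_orthogonal_ext_class\<close>), so it passes to the hulls in one
  argument after the other (\<open>Hom_zero_ext_hull\<close>).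

  For the decomposition of \<open>X\<close>, cut its filtration at the point where the phases enter \<open>\<Phi>\<^sub>+\<close>.
  The tail \<open>F\<^sup>k X\<close> is an iterated extension of objects of \<open>P\<^sub>+\<close>, and by the octahedral axiom the cone
  of \<open>F\<^sup>k X \<rightarrow> X\<close> is an iterated extension of objects of \<open>P\<^sub>-\<close> (\<open>decomposable_step\<close>).
\<close>

section \<open>Additive categories\<close>

context category
begin

lemma Homs_obj:
  assumes "f \<in> Homs C A B"
  shows "A \<in> Obj C" and "B \<in> Obj C"
  using assms dom_obj cod_obj by (auto simp: Homs_def)

lemma iso_arrowE:
  assumes "iso_arrow C A B f"
  obtains g where "f \<in> Homs C A B" "g \<in> Homs C B A" "g \<cdot> f = Id C A" "f \<cdot> g = Id C B"
  using assms by (auto simp: iso_arrow_def)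

end

context additive_category
begin

lemma Zero_hom: "A \<in> Obj C \<Longrightarrow> B \<in> Obj C \<Longrightarrow> Zero C A B \<in> Homs C A B"
  using hom_comm_group[THEN comm_group.axioms(2), THEN group.is_monoid, THEN monoid.one_closed]
  by (simp add: hom_group_def)

lemma Neg_hom:
  assumes "f \<in> Homs C A B"
  shows "Neg C f \<in> Homs C A B"
    and "Neg C (Neg C f) = f"
    and "Plus C f (Neg C f) = Zero C A B"
proof -
  interpret G: comm_group "hom_group C A B"
    using assms by (intro hom_comm_group Homs_obj)
  have N: "Neg C g = m_inv (hom_group C A B) g" if "g \<in> Homs C A B" for g
    using that by (simp add: Neg_def Homs_def)
  have car: "carrier (hom_group C A B) = Homs C A B"
    and mult: "\<And>g. f \<otimes>\<^bsub>hom_group C A B\<^esub> g = Plus C f g"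
    and one: "\<one>\<^bsub>hom_group C A B\<^esub> = Zero C A B"
    by (simp_all add: hom_group_def)
  show cl: "Neg C f \<in> Homs C A B"
    using assms G.inv_closed[of f] by (simp add: N car)
  show "Neg C (Neg C f) = f"
    using assms cl by (simp add: N[OF cl]) (simp add: N[OF assms] car)
  show "Plus C f (Neg C f) = Zero C A B"
    using assms G.r_inv[of f] by (simp add: N car mult one)
qed

lemma Plus_self_imp_Zero:
  assumes "f \<in> Homs C A B" and "Plus C f f = f"
  shows "f = Zero C A B"
proof -
  interpret G: comm_group "hom_group C A B"
    using assms by (intro hom_comm_group Homs_obj)
  show ?thesis
    using G.r_cancel_one[of f f] assms by (simp add: hom_group_def)
qed

lemma Plus_Zero:
  assumes "f \<in> Homs C A B"
  shows "Plus C f (Zero C A B) = f"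
proof -
  interpret G: comm_group "hom_group C A B"
    using assms by (intro hom_comm_group Homs_obj)
  show ?thesis
    using G.r_one[of f] assms by (simp add: hom_group_def)
qed

lemma comp_Zero:
  assumes "g \<in> Homs C B D" and "A \<in> Obj C"
  shows "g \<cdot> Zero C A B = Zero C A D"
proof -
  have z: "Zero C A B \<in> Homs C A B"
    using Zero_hom[OF assms(2) Homs_obj(1)[OF assms(1)]] .
  show ?thesis
    using comp_plus_right[OF z z assms(1)] Plus_Zero[OF z] comp_hom[OF z assms(1)]
    by (intro Plus_self_imp_Zero) auto
qed

lemma Zero_comp:
  assumes "f \<in> Homs C A B" and "D \<in> Obj C"
  shows "Zero C B D \<cdot> f = Zero C A D"
proof -
  have z: "Zero C B D \<in> Homs C B D"
    using Zero_hom[OF Homs_obj(2)[OF assms(1)] assms(2)] .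
  show ?thesis
    using comp_plus_left[OF assms(1) z z] Plus_Zero[OF z] comp_hom[OF assms(1) z]
    by (intro Plus_self_imp_Zero) auto
qed

lemma zero_object_hom_to:
  assumes "zero_object C Z" and "f \<in> Homs C A Z"
  shows "f = Zero C A Z"
  using assms Zero_hom[OF Homs_obj[OF assms(2)]] Homs_obj[OF assms(2)]
  unfolding zero_object_def by blast

lemma zero_object_hom_from:
  assumes "zero_object C Z" and "f \<in> Homs C Z A"
  shows "f = Zero C Z A"
  using assms Zero_hom[OF Homs_obj[OF assms(2)]] Homs_obj[OF assms(2)]
  unfolding zero_object_def by blast

end

section \<open>The shift\<close>

context triangulated_category
begin

lemma ShO_obj: "A \<in> Obj T \<Longrightarrow> ShO T A \<in> Obj T"
  using shift_obj_bij by (auto simp: bij_betw_def)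

lemma ex_unshift_obj:
  assumes "B \<in> Obj T"
  obtains A where "A \<in> Obj T" and "B = ShO T A"
  using assms shift_obj_bij by (auto simp: bij_betw_def)

lemma ShO_inj: "A \<in> Obj T \<Longrightarrow> B \<in> Obj T \<Longrightarrow> ShO T A = ShO T B \<longleftrightarrow> A = B"
  using shift_obj_bij by (auto simp: bij_betw_def dest: inj_onD)

lemma shift_ob_simps:
  "shift_ob T 0 X = X" "shift_ob T 1 X = ShO T X"
  "A \<in> Obj T \<Longrightarrow> shift_ob T (- 1) (ShO T A) = A"
  using shift_obj_bij by (auto simp: shift_ob_def bij_betw_def)

text \<open>
  Full faithfulness of the shift: the axioms give a bijection on all morphisms only, and
  injectivity on objects brings the preimage of a morphism \<open>A[1] \<rightarrow> B[1]\<close> back to \<open>Hom(A, B)\<close>.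
\<close>

lemma shift_hom_bij:
  assumes "A \<in> Obj T" and "B \<in> Obj T"
  shows "bij_betw (ShM T) (Homs T A B) (Homs T (ShO T A) (ShO T B))"
  unfolding bij_betw_def
proof
  show "inj_on (ShM T) (Homs T A B)"
    using shift_mor_bij by (auto simp: bij_betw_def Homs_def intro: inj_on_subset)
  have "f \<in> ShM T ` Homs T A B" if f: "f \<in> Homs T (ShO T A) (ShO T B)" for f
  proof -
    obtain g where g: "g \<in> Mor T" "f = ShM T g"
      using f shift_mor_bij by (auto simp: bij_betw_def Homs_def)
    then have h: "g \<in> Homs T (Dom T g) (Cod T g)"
      by (simp add: Homs_def)
    have "Dom T g = A" "Cod T g = B"
      using shift_hom[OF h] f g Homs_obj[OF h] assms ShO_inj by (auto simp: Homs_def)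
    then show ?thesis
      using h g by auto
  qed
  then show "ShM T ` Homs T A B = Homs T (ShO T A) (ShO T B)"
    using shift_hom by blast
qed

lemma ex_unshift_hom:
  assumes "A \<in> Obj T" and "B \<in> Obj T" and "f \<in> Homs T (ShO T A) (ShO T B)"
  obtains g where "g \<in> Homs T A B" and "f = ShM T g"
  using shift_hom_bij[OF assms(1,2)] assms(3) by (auto simp: bij_betw_def)

lemma shift_Zero:
  assumes "A \<in> Obj T" and "B \<in> Obj T"
  shows "ShM T (Zero T A B) = Zero T (ShO T A) (ShO T B)"
proof -
  have z: "Zero T A B \<in> Homs T A B"
    using assms by (rule Zero_hom)
  show ?thesis
    using shift_plus[OF z z] Plus_Zero[OF z] shift_hom[OF z]
    by (intro Plus_self_imp_Zero) auto
qed

lemma ShM_eq_Zero_iff: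
  assumes "f \<in> Homs T A B"
  shows "ShM T f = Zero T (ShO T A) (ShO T B) \<longleftrightarrow> f = Zero T A B"
proof -
  have AB: "A \<in> Obj T" "B \<in> Obj T"
    using Homs_obj[OF assms] by auto
  then show ?thesis
    using inj_on_eq_iff[OF bij_betw_imp_inj_on[OF shift_hom_bij[OF AB]] assms Zero_hom[OF AB]]
    by (simp add: shift_Zero[OF AB])
qed

lemma shift_iso:
  assumes "iso_objects T A B"
  shows "iso_objects T (ShO T A) (ShO T B)"
proof -
  obtain f where "iso_arrow T A B f"
    using assms by (auto simp: iso_objects_def)
  then obtain g where fg: "f \<in> Homs T A B" "g \<in> Homs T B A" "g \<cdot> f = Id T A" "f \<cdot> g = Id T B"
    by (rule iso_arrowE)
  then have "ShM T g \<cdot> ShM T f = Id T (ShO T A)" "ShM T f \<cdot> ShM T g = Id T (ShO T B)"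
    by (metis shift_comp shift_id Homs_obj)+
  then show ?thesis
    using shift_hom[OF fg(1)] shift_hom[OF fg(2)]
    by (auto simp: iso_objects_def iso_arrow_def)
qed

lemma unshift_iso:
  assumes iso: "iso_objects T (ShO T A) (ShO T B)" and A: "A \<in> Obj T" and B: "B \<in> Obj T"
  shows "iso_objects T A B"
proof -
  obtain f where "iso_arrow T (ShO T A) (ShO T B) f"
    using iso by (auto simp: iso_objects_def)
  then obtain g where fg: "f \<in> Homs T (ShO T A) (ShO T B)" "g \<in> Homs T (ShO T B) (ShO T A)"
    "g \<cdot> f = Id T (ShO T A)" "f \<cdot> g = Id T (ShO T B)"
    by (rule iso_arrowE)
  obtain f' where f': "f' \<in> Homs T A B" "f = ShM T f'"
    using ex_unshift_hom[OF A B fg(1)] .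
  obtain g' where g': "g' \<in> Homs T B A" "g = ShM T g'"
    using ex_unshift_hom[OF B A fg(2)] .
  have "ShM T (g' \<cdot> f') = ShM T (Id T A)" "ShM T (f' \<cdot> g') = ShM T (Id T B)"
    using fg(3,4) f' g' A B by (simp_all add: shift_comp[OF f'(1) g'(1)] shift_comp[OF g'(1) f'(1)] shift_id)
  moreover have "g' \<cdot> f' \<in> Homs T A A" "f' \<cdot> g' \<in> Homs T B B"
    using comp_hom[OF f'(1) g'(1)] comp_hom[OF g'(1) f'(1)] .
  ultimately have "g' \<cdot> f' = Id T A" "f' \<cdot> g' = Id T B"
    using shift_hom_bij[OF A A] shift_hom_bij[OF B B] id_hom[OF A] id_hom[OF B]
    by (auto simp: bij_betw_def dest: inj_onD)
  then show ?thesis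
    using f'(1) g'(1) by (auto simp: iso_objects_def iso_arrow_def)
qed

lemma zero_object_shift_iff:
  assumes Z: "Z \<in> Obj T"
  shows "zero_object T (ShO T Z) \<longleftrightarrow> zero_object T Z"
proof -
  have ex1_iff: "(\<exists>!y. y \<in> Y) \<longleftrightarrow> (\<exists>!x. x \<in> X)" if "bij_betw s X Y"
    for s :: "'m \<Rightarrow> 'm" and X Y
    using that unfolding bij_betw_def inj_on_def by blast
  have "zero_object T (ShO T Z) \<longleftrightarrow> (\<forall>B \<in> ShO T ` Obj T.
      (\<exists>!f. f \<in> Homs T B (ShO T Z)) \<and> (\<exists>!f. f \<in> Homs T (ShO T Z) B))"
    using ShO_obj[OF Z] shift_obj_bij by (simp add: zero_object_def bij_betw_def)
  also have "\<dots> \<longleftrightarrow> zero_object T Z"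
    using Z ex1_iff[OF shift_hom_bij[OF _ Z]] ex1_iff[OF shift_hom_bij[OF Z]]
    by (simp add: zero_object_def)
  finally show ?thesis .
qed

section \<open>Triangles and the long exact sequences\<close>

lemma dist_triangle_homs:
  assumes "dist_triangle T X Y Z u v w"
  shows "u \<in> Homs T X Y" "v \<in> Homs T Y Z" "w \<in> Homs T Z (ShO T X)"
  using assms by (auto simp: dist_triangle_def)

lemma dist_triangle_obj:
  assumes "dist_triangle T X Y Z u v w"
  shows "X \<in> Obj T" "Y \<in> Obj T" "Z \<in> Obj T"
  using dist_triangle_homs[OF assms] Homs_obj by blast+

lemma rotate_triangle:
  assumes "dist_triangle T X Y Z u v w"
  shows "dist_triangle T Y Z (ShO T X) v w (Neg T (ShM T u))"
  using dist_rotate[OF dist_triangle_homs[OF assms]] assms by blast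

lemma shift_triangle:
  assumes "dist_triangle T X Y Z u v w"
  shows "dist_triangle T (ShO T X) (ShO T Y) (ShO T Z)
    (Neg T (ShM T u)) (Neg T (ShM T v)) (Neg T (ShM T w))"
  using rotate_triangle[OF rotate_triangle[OF rotate_triangle[OF assms]]] .

text \<open>
  A triangle can be rotated backwards as soon as its third object is of the form \<open>X[1]\<close>, because every
  morphism \<open>X[1] \<rightarrow> Y[1]\<close> is the negative of a shifted one.
\<close>

lemma unrotate_triangle:
  assumes tri: "dist_triangle T Y Z (ShO T X) v w t" and X: "X \<in> Obj T"
  obtains u where "dist_triangle T X Y Z u v w"
proof -
  have Y: "Y \<in> Obj T" and t: "t \<in> Homs T (ShO T X) (ShO T Y)"
    using dist_triangle_obj[OF tri] dist_triangle_homs[OF tri] by auto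
  obtain u where u: "u \<in> Homs T X Y" "Neg T t = ShM T u"
    using ex_unshift_hom[OF X Y Neg_hom(1)[OF t]] .
  have "t = Neg T (ShM T u)"
    using Neg_hom(2)[OF t] u by simp
  then have "dist_triangle T X Y Z u v w"
    using dist_rotate[OF u(1)] dist_triangle_homs[OF tri] tri by blast
  then show thesis ..
qed

lemma unshift_triangle:
  assumes tri: "dist_triangle T (ShO T X) (ShO T Y) (ShO T Z) u v w"
    and X: "X \<in> Obj T" and Y: "Y \<in> Obj T" and Z: "Z \<in> Obj T"
  shows "\<exists>u' v' w'. dist_triangle T X Y Z u' v' w'"
proof -
  obtain w' where "dist_triangle T Z (ShO T X) (ShO T Y) w' u v"
    using unrotate_triangle[OF tri Z] .
  then obtain v' where "dist_triangle T Y Z (ShO T X) v' w' u"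
    using unrotate_triangle[OF _ Y] by blast
  then obtain u' where "dist_triangle T X Y Z u' v' w'"
    using unrotate_triangle[OF _ X] by blast
  then show ?thesis
    by blast
qed

text \<open>
  Exactness of \<open>Hom(-, W)\<close>: a morphism \<open>f\<close> that kills \<open>u\<close> is a morphism of triangles from
  \<open>(u, v, w)\<close> to \<open>0 \<rightarrow> W \<rightarrow> W \<rightarrow> 0\<close>, whose third component is the factorisation.
\<close>

lemma triangle_weak_cokernel:
  assumes tri: "dist_triangle T X Y Z u v w" and f: "f \<in> Homs T Y W"
    and fu: "f \<cdot> u = Zero T X W"
  shows "\<exists>h \<in> Homs T Z W. f = h \<cdot> v"
proof -
  have W: "W \<in> Obj T"
    using Homs_obj[OF f] by blast
  obtain O' where zero: "zero_object T O'"
    using ex_zero_object by blast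
  then have O': "O' \<in> Obj T"
    by (simp add: zero_object_def)
  have "zero_object T (ShO T O')"
    using zero zero_object_shift_iff[OF O'] by blast
  from dist_id[OF W this] obtain z where
    z: "dist_triangle T O' W W z (Id T W) (Zero T W (ShO T O'))"
    using unrotate_triangle[OF _ O'] by blast
  have X0: "Zero T X O' \<in> Homs T X O'"
    using O' dist_triangle_obj[OF tri] by (intro Zero_hom)
  have "z \<cdot> Zero T X O' = f \<cdot> u"
    using comp_Zero[OF dist_triangle_homs(1)[OF z]] dist_triangle_obj[OF tri] fu by simp
  from dist_morphism[OF tri z X0 f this] show ?thesis
    using id_left[OF f] by auto
qed

text \<open>
  Exactness of \<open>Hom(W, -)\<close> at the middle term, when the first term vanishes.  The pair
  \<open>(f, 0)\<close> extends to a morphism from the rotated triangle \<open>W \<rightarrow> 0 \<rightarrow> W[1] \<rightarrow> W[1]\<close>, whose last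
  arrow is \<open>-1\<close>, to the rotation of \<open>(u, v, w)\<close>.  The third component lies in
  \<open>Hom(W[1], X[1]) = 0\<close>, which forces \<open>f[1] = 0\<close>.
\<close>

lemma triangle_left_cancel_zero:
  assumes tri: "dist_triangle T X Y Z u v w" and f: "f \<in> Homs T W Y"
    and vf: "v \<cdot> f = Zero T W Z" and WX: "Homs T W X = {Zero T W X}"
  shows "f = Zero T W Y"
proof -
  have W: "W \<in> Obj T"
    using Homs_obj[OF f] by blast
  note obj = dist_triangle_obj[OF tri]
  note SW = ShO_obj[OF W] and SX = ShO_obj[OF obj(1)] and SY = ShO_obj[OF obj(2)]
  obtain O' where zero: "zero_object T O'"
    using ex_zero_object by blast
  then have O': "O' \<in> Obj T"
    by (simp add: zero_object_def)
  define e where "e = Neg T (Id T (ShO T W))"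
  have tri0: "dist_triangle T W O' (ShO T W) (Zero T W O') (Zero T O' (ShO T W)) e"
    using rotate_triangle[OF dist_id[OF W zero]] by (simp add: e_def shift_id[OF W])
  have O0: "Zero T O' Z \<in> Homs T O' Z"
    using O' obj by (intro Zero_hom)
  have "v \<cdot> f = Zero T O' Z \<cdot> Zero T W O'"
    using vf comp_Zero[OF O0 W] by simp
  from dist_morphism[OF tri0 rotate_triangle[OF tri] f O0 this]
  obtain h where h: "h \<in> Homs T (ShO T W) (ShO T X)" "Neg T (ShM T u) \<cdot> h = ShM T f \<cdot> e"
    by blast
  obtain h' where "h' \<in> Homs T W X" "h = ShM T h'"
    using ex_unshift_hom[OF W obj(1) h(1)] .
  then have "h = Zero T (ShO T W) (ShO T X)"
    using WX shift_Zero[OF W obj(1)] by simp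
  then have fe: "ShM T f \<cdot> e = Zero T (ShO T W) (ShO T Y)"
    using h(2) comp_Zero[OF Neg_hom(1)[OF shift_hom[OF dist_triangle_homs(1)[OF tri]]] SW] by simp
  have I: "Id T (ShO T W) \<in> Homs T (ShO T W) (ShO T W)"
    using id_hom[OF SW] .
  have Sf: "ShM T f \<in> Homs T (ShO T W) (ShO T Y)"
    using shift_hom[OF f] .
  have "ShM T f = Plus T (ShM T f) (ShM T f \<cdot> e)"
    by (simp add: fe Plus_Zero[OF Sf])
  also have "\<dots> = ShM T f \<cdot> Plus T (Id T (ShO T W)) e"
    using comp_plus_right[OF I Neg_hom(1)[OF I] Sf] id_right[OF Sf] by (simp add: e_def)
  also have "\<dots> = Zero T (ShO T W) (ShO T Y)"
    using Neg_hom(3)[OF I] comp_Zero[OF Sf SW] by (simp add: e_def)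
  finally show ?thesis
    using ShM_eq_Zero_iff[OF f] by blast
qed

end

section \<open>Extension hulls\<close>

definition ext_class :: "('o, 'm, 'z) triang_cat_scheme \<Rightarrow> 'o set \<Rightarrow> bool" where
  "ext_class T P \<longleftrightarrow>
     strictly_full T P \<and> extension_closed T P \<and> (\<forall>Z. zero_object T Z \<longrightarrow> Z \<in> P)"

lemma ext_hull_eq: "ext_hull T S = \<Inter> {P. ext_class T P \<and> S \<subseteq> P}"
  unfolding ext_hull_def ext_class_def by (rule arg_cong[of _ _ Inter]) blast

lemma ext_hull_least: "ext_class T P \<Longrightarrow> S \<subseteq> P \<Longrightarrow> ext_hull T S \<subseteq> P"
  unfolding ext_hull_eq by blast

lemma ext_hull_superset: "S \<subseteq> ext_hull T S"
  unfolding ext_hull_eq by blast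

lemma ext_class_extension:
  "ext_class T P \<Longrightarrow> dist_triangle T A B D u v w \<Longrightarrow> A \<in> P \<Longrightarrow> D \<in> P \<Longrightarrow> B \<in> P"
  unfolding ext_class_def extension_closed_def by blast

lemma ext_class_obj: "ext_class T P \<Longrightarrow> P \<subseteq> Obj T"
  unfolding ext_class_def strictly_full_def by blast

context triangulated_category
begin

lemma ext_class_Obj: "ext_class T (Obj T)"
  using dist_triangle_obj Homs_obj
  by (fastforce simp: ext_class_def strictly_full_def extension_closed_def zero_object_def
      iso_objects_def iso_arrow_def)

text \<open>
  The hypothesis on \<open>S\<close> guarantees that the intersection defining the hull is not over the empty
  family: \<open>Obj T\<close> is a member.
\<close>

lemma ext_class_ext_hull:
  assumes "S \<subseteq> Obj T"
  shows "ext_class T (ext_hull T S)"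
proof -
  have "ext_hull T S \<subseteq> Obj T"
    using ext_hull_least[OF ext_class_Obj assms] .
  then show ?thesis
    unfolding ext_class_def strictly_full_def extension_closed_def ext_hull_eq by blast
qed

lemma ext_class_unshift:
  assumes "ext_class T P"
  shows "ext_class T {X \<in> Obj T. ShO T X \<in> P}"
  unfolding ext_class_def strictly_full_def extension_closed_def
proof (intro conjI allI impI ballI; (elim conjE)?)
  fix A B assume "A \<in> {X \<in> Obj T. ShO T X \<in> P}" "iso_objects T A B"
  then show "B \<in> {X \<in> Obj T. ShO T X \<in> P}"
    using assms shift_iso[of A B] Homs_obj
    unfolding ext_class_def strictly_full_def iso_objects_def iso_arrow_def by blast
next
  fix A B D u v w
  assume "dist_triangle T A B D u v w"
    "A \<in> {X \<in> Obj T. ShO T X \<in> P}" "D \<in> {X \<in> Obj T. ShO T X \<in> P}"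
  then show "B \<in> {X \<in> Obj T. ShO T X \<in> P}"
    using ext_class_extension[OF assms shift_triangle] dist_triangle_obj(2) by blast
next
  fix Z assume Z: "zero_object T Z"
  then have "Z \<in> Obj T"
    by (simp add: zero_object_def)
  with Z show "Z \<in> {X \<in> Obj T. ShO T X \<in> P}"
    using zero_object_shift_iff[of Z] assms by (auto simp: ext_class_def)
qed auto

lemma ext_class_shift:
  assumes "ext_class T P"
  shows "ext_class T (ShO T ` P)"
  unfolding ext_class_def strictly_full_def extension_closed_def
proof (intro conjI allI impI ballI; (elim conjE)?)
  show "ShO T ` P \<subseteq> Obj T"
    using ext_class_obj[OF assms] ShO_obj by blast
next
  fix A B assume "A \<in> ShO T ` P" and AB: "iso_objects T A B"
  then obtain A' where A': "A' \<in> P" "A = ShO T A'"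
    by blast
  have "B \<in> Obj T"
    using AB Homs_obj by (auto simp: iso_objects_def iso_arrow_def)
  then obtain B' where B': "B' \<in> Obj T" "B = ShO T B'"
    by (rule ex_unshift_obj)
  have "iso_objects T A' B'"
    using unshift_iso[of A' B'] AB A' B' ext_class_obj[OF assms] by auto
  then show "B \<in> ShO T ` P"
    using assms A' B' by (auto simp: ext_class_def strictly_full_def)
next
  fix A B D u v w
  assume tri: "dist_triangle T A B D u v w" and "A \<in> ShO T ` P" "D \<in> ShO T ` P"
  then obtain A' D' where A': "A' \<in> P" "A = ShO T A'" and D': "D' \<in> P" "D = ShO T D'"
    by blast
  obtain B' where B': "B' \<in> Obj T" "B = ShO T B'"
    using ex_unshift_obj[OF dist_triangle_obj(2)[OF tri]] .
  obtain u' v' w' where "dist_triangle T A' B' D' u' v' w'"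
    using unshift_triangle[of A' B' D' u v w] tri A' B' D' ext_class_obj[OF assms] by auto
  then show "B \<in> ShO T ` P"
    using ext_class_extension[OF assms] A' B' D' by blast
next
  fix Z assume Z: "zero_object T Z"
  then have "Z \<in> Obj T"
    by (simp add: zero_object_def)
  then obtain Z' where Z': "Z' \<in> Obj T" "Z = ShO T Z'"
    by (rule ex_unshift_obj)
  then show "Z \<in> ShO T ` P"
    using Z zero_object_shift_iff[of Z'] assms by (auto simp: ext_class_def)
qed

lemma ext_hull_shift:
  assumes "S \<subseteq> Obj T"
  shows "ext_hull T (ShO T ` S) = ShO T ` ext_hull T S"
proof
  show "ext_hull T (ShO T ` S) \<subseteq> ShO T ` ext_hull T S"
    by (intro ext_hull_least ext_class_shift ext_class_ext_hull assms image_mono ext_hull_superset)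
  have "ShO T ` S \<subseteq> Obj T"
    using assms ShO_obj by blast
  then have "ext_hull T S \<subseteq> {X \<in> Obj T. ShO T X \<in> ext_hull T (ShO T ` S)}"
    using assms ext_hull_superset[of "ShO T ` S" T]
    by (intro ext_hull_least ext_class_unshift ext_class_ext_hull) auto
  then show "ShO T ` ext_hull T S \<subseteq> ext_hull T (ShO T ` S)"
    by blast
qed

lemma left_orthogonal_ext_class:
  assumes Y: "Y \<in> Obj T"
  shows "ext_class T {X \<in> Obj T. Homs T X Y = {Zero T X Y}}"
  unfolding ext_class_def strictly_full_def extension_closed_def
proof (intro conjI allI impI ballI; (elim conjE)?)
  fix A B assume A: "A \<in> {X \<in> Obj T. Homs T X Y = {Zero T X Y}}" and AB: "iso_objects T A B"
  obtain f where "iso_arrow T A B f"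
    using AB by (auto simp: iso_objects_def)
  then obtain g where fg: "f \<in> Homs T A B" "g \<in> Homs T B A" "f \<cdot> g = Id T B"
    by (rule iso_arrowE)
  have B: "B \<in> Obj T"
    using Homs_obj[OF fg(1)] by blast
  have "h = Zero T B Y" if h: "h \<in> Homs T B Y" for h
  proof -
    have "h \<cdot> f = Zero T A Y"
      using A comp_hom[OF fg(1) h] by blast
    then have "(h \<cdot> f) \<cdot> g = Zero T B Y"
      using Zero_comp[OF fg(2) Y] by simp
    then show ?thesis
      using comp_assoc[OF fg(2,1) h] fg(3) id_right[OF h] by simp
  qed
  then show "B \<in> {X \<in> Obj T. Homs T X Y = {Zero T X Y}}"
    using B Zero_hom[OF B Y] by blast
next
  fix A B D u v w
  assume tri: "dist_triangle T A B D u v w"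
    and A: "A \<in> {X \<in> Obj T. Homs T X Y = {Zero T X Y}}"
    and D: "D \<in> {X \<in> Obj T. Homs T X Y = {Zero T X Y}}"
  have B: "B \<in> Obj T"
    using dist_triangle_obj[OF tri] by blast
  have "f = Zero T B Y" if f: "f \<in> Homs T B Y" for f
  proof -
    have "f \<cdot> u = Zero T A Y"
      using comp_hom[OF dist_triangle_homs(1)[OF tri] f] A by blast
    then obtain h where "h \<in> Homs T D Y" "f = h \<cdot> v"
      using triangle_weak_cokernel[OF tri f] by blast
    then show ?thesis
      using D Zero_comp[OF dist_triangle_homs(2)[OF tri] Y] by simp
  qed
  then show "B \<in> {X \<in> Obj T. Homs T X Y = {Zero T X Y}}"
    using B Zero_hom[OF B Y] by blast
next
  fix Z assume Z: "zero_object T Z"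
  then have "Z \<in> Obj T"
    by (simp add: zero_object_def)
  then show "Z \<in> {X \<in> Obj T. Homs T X Y = {Zero T X Y}}"
    using zero_object_hom_from[OF Z] Zero_hom[of Z Y] Y by blast
qed auto

lemma right_orthogonal_ext_class:
  assumes X: "X \<in> Obj T"
  shows "ext_class T {Y \<in> Obj T. Homs T X Y = {Zero T X Y}}"
  unfolding ext_class_def strictly_full_def extension_closed_def
proof (intro conjI allI impI ballI; (elim conjE)?)
  fix A B assume A: "A \<in> {Y \<in> Obj T. Homs T X Y = {Zero T X Y}}" and AB: "iso_objects T A B"
  obtain f where "iso_arrow T A B f"
    using AB by (auto simp: iso_objects_def)
  then obtain g where fg: "f \<in> Homs T A B" "g \<in> Homs T B A" "f \<cdot> g = Id T B"
    by (rule iso_arrowE)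
  have B: "B \<in> Obj T"
    using Homs_obj[OF fg(1)] by blast
  have "h = Zero T X B" if h: "h \<in> Homs T X B" for h
  proof -
    have "g \<cdot> h = Zero T X A"
      using A comp_hom[OF h fg(2)] by blast
    then have "f \<cdot> (g \<cdot> h) = Zero T X B"
      using comp_Zero[OF fg(1) X] by simp
    then show ?thesis
      using comp_assoc[OF h fg(2,1)] fg(3) id_left[OF h] by simp
  qed
  then show "B \<in> {Y \<in> Obj T. Homs T X Y = {Zero T X Y}}"
    using B Zero_hom[OF X B] by blast
next
  fix A B D u v w
  assume tri: "dist_triangle T A B D u v w"
    and A: "A \<in> {Y \<in> Obj T. Homs T X Y = {Zero T X Y}}"
    and D: "D \<in> {Y \<in> Obj T. Homs T X Y = {Zero T X Y}}"
  have B: "B \<in> Obj T"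
    using dist_triangle_obj[OF tri] by blast
  have "f = Zero T X B" if f: "f \<in> Homs T X B" for f
    using triangle_left_cancel_zero[OF tri f] A comp_hom[OF f dist_triangle_homs(2)[OF tri]] D
    by blast
  then show "B \<in> {Y \<in> Obj T. Homs T X Y = {Zero T X Y}}"
    using B Zero_hom[OF X B] by blast
next
  fix Z assume Z: "zero_object T Z"
  then have "Z \<in> Obj T"
    by (simp add: zero_object_def)
  then show "Z \<in> {Y \<in> Obj T. Homs T X Y = {Zero T X Y}}"
    using zero_object_hom_to[OF Z] Zero_hom[of X Z] X by blast
qed auto

lemma Hom_zero_ext_hull:
  assumes P: "P \<subseteq> Obj T" and Q: "Q \<subseteq> Obj T"
    and orth: "\<And>X Y. X \<in> P \<Longrightarrow> Y \<in> Q \<Longrightarrow> Homs T X Y = {Zero T X Y}"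
    and X: "X \<in> ext_hull T P" and Y: "Y \<in> ext_hull T Q"
  shows "Homs T X Y = {Zero T X Y}"
proof -
  have "ext_hull T Q \<subseteq> {Y \<in> Obj T. Homs T X' Y = {Zero T X' Y}}" if "X' \<in> P" for X'
    using that P Q orth by (intro ext_hull_least right_orthogonal_ext_class) auto
  then have "ext_hull T P \<subseteq> {X \<in> Obj T. Homs T X Y = {Zero T X Y}}"
    using P Y ext_class_obj[OF ext_class_ext_hull[OF Q]]
    by (intro ext_hull_least left_orthogonal_ext_class) auto
  then show ?thesis
    using X by blast
qed

section \<open>Decomposition along a filtration\<close>

definition decomposable :: "'o set \<Rightarrow> 'o set \<Rightarrow> 'o \<Rightarrow> bool" where
  "decomposable D E X \<longleftrightarrow> (\<exists>A \<in> D. \<exists>B \<in> E. \<exists>u v w. dist_triangle T A X B u v w)"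

lemma decomposable_left:
  assumes "ext_class T D" and "ext_class T E" and "X \<in> D"
  shows "decomposable D E X"
proof -
  obtain Z where Z: "zero_object T Z"
    using ex_zero_object by blast
  have "X \<in> Obj T" "Z \<in> E"
    using assms Z ext_class_obj[of T D] by (auto simp: ext_class_def)
  then show ?thesis
    using dist_id[OF _ Z] assms(3) unfolding decomposable_def by blast
qed

text \<open>
  If \<open>A \<rightarrow> Y \<rightarrow> B\<close> decomposes \<open>Y\<close>, the octahedron on \<open>A \<rightarrow> Y \<rightarrow> X\<close> exhibits the cone of the
  composite as an extension of \<open>G\<close> by \<open>B\<close>.
\<close>

lemma decomposable_step:
  assumes E: "ext_class T E" and Y: "decomposable D E Y"
    and tri: "dist_triangle T Y X G a b c" and G: "G \<in> E"
  shows "decomposable D E X"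
proof -
  obtain A B u v w where AB: "A \<in> D" "B \<in> E" and t: "dist_triangle T A Y B u v w"
    using Y unfolding decomposable_def by blast
  obtain B' k k' where t': "dist_triangle T A X B' (a \<cdot> u) k k'"
    using dist_extend[OF comp_hom[OF dist_triangle_homs(1)[OF t] dist_triangle_homs(1)[OF tri]]]
    by blast
  obtain f g where "dist_triangle T B B' G f g (ShM T v \<cdot> c)"
    using octahedron[OF t tri t'] by blast
  then have "B' \<in> E"
    using ext_class_extension[OF E] AB(2) G by blast
  then show ?thesis
    using AB(1) t' unfolding decomposable_def by blast
qed

text \<open>
  Downward induction along the filtration.  It carries the second conjunct, that \<open>F i\<close> lies in
  \<open>D\<close> itself, for as long as only factors from \<open>D\<close> have been met; the monotonicity hypothesis says
  that these come last.
\<close>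

lemma decomposable_filtration:
  fixes n :: nat
  assumes D: "ext_class T D" and E: "ext_class T E"
    and end_zero: "zero_object T (F (Suc n))"
    and tri: "\<And>i. i \<le> n \<Longrightarrow> \<exists>u v w. dist_triangle T (F (Suc i)) (F i) (G i) u v w"
    and in_D: "\<And>i. i \<le> n \<Longrightarrow> up i \<Longrightarrow> G i \<in> D"
    and in_E: "\<And>i. i \<le> n \<Longrightarrow> \<not> up i \<Longrightarrow> G i \<in> E"
    and up: "\<And>i. i < n \<Longrightarrow> up i \<Longrightarrow> up (Suc i)"
  shows "decomposable D E (F 0)"
proof -
  have "decomposable D E (F i) \<and> (i = Suc n \<or> up i \<longrightarrow> F i \<in> D)" if "i \<le> Suc n" for i
    using that
  proof (induction i rule: inc_induct)
    case base
    have "F (Suc n) \<in> D"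
      using D end_zero by (auto simp: ext_class_def)
    then show ?case
      using decomposable_left[OF D E] by blast
  next
    case (step i)
    then have i: "i \<le> n"
      by simp
    obtain u v w where t: "dist_triangle T (F (Suc i)) (F i) (G i) u v w"
      using tri[OF i] by blast
    show ?case
    proof (cases "up i")
      case True
      then have "Suc i = Suc n \<or> up (Suc i)"
        using up[of i] i by linarith
      then have "F (Suc i) \<in> D"
        using step.IH by blast
      then have "F i \<in> D"
        using ext_class_extension[OF D t] in_D[OF i True] by blast
      then show ?thesis
        using decomposable_left[OF D E] by blast
    next
      case False
      then show ?thesis
        using decomposable_step[OF E _ t in_E[OF i False]] step i by auto
    qed
  qed
  then show ?thesis
    by blast
qed

end

section \<open>The t-structure of a cut\<close>

theorem lemma5p1:
  fixes T :: "('o, 'm) triang_cat"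
    and \<Phi> \<Phi>m \<Phi>p :: "'p::linorder set"
    and \<P> :: "'p \<Rightarrow> 'o set"
    and \<tau> :: "'p \<Rightarrow> 'p"
  assumes "triangulated_category T"
    and "t_stability T \<Phi> \<P>"
    and "shift_automorphism T \<Phi> \<P> \<tau>"
    and "\<Phi> = \<Phi>m \<union> \<Phi>p" and "\<Phi>m \<inter> \<Phi>p = {}"
    and "\<forall>\<phi>m \<in> \<Phi>m. \<forall>\<phi>p \<in> \<Phi>p. \<phi>m < \<phi>p"
  shows "t_structure T (ext_hull T (\<Union>\<phi>\<in>\<Phi>p. \<P> \<phi>)) (ext_hull T (\<Union>\<phi>\<in>\<tau> ` \<Phi>m. \<P> \<phi>))"
proof -
  interpret triangulated_category T
    by (rule assms(1))
  define Pp Pm where "Pp = (\<Union>\<phi>\<in>\<Phi>p. \<P> \<phi>)" and "Pm = (\<Union>\<phi>\<in>\<Phi>m. \<P> \<phi>)"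
  define D E where "D = ext_hull T Pp" and "E = ext_hull T Pm"
  note stab = assms(2)[unfolded t_stability_def]
  note aut = assms(3)[unfolded shift_automorphism_def]

  have P_obj: "\<P> \<phi> \<subseteq> Obj T" if "\<phi> \<in> \<Phi>" for \<phi>
    using stab that by (auto simp: strictly_full_def)
  then have Pp: "Pp \<subseteq> Obj T" and Pm: "Pm \<subseteq> Obj T"
    using assms(4) by (auto simp: Pp_def Pm_def)
  have D: "ext_class T D" and E: "ext_class T E"
    using ext_class_ext_hull Pp Pm by (auto simp: D_def E_def)
  have shift_P: "\<P> (\<tau> \<phi>) = ShO T ` \<P> \<phi>" if "\<phi> \<in> \<Phi>" for \<phi>
    using aut that by (auto simp: shift_ob_simps)
  then have "(\<Union>\<phi>\<in>\<tau> ` \<Phi>m. \<P> \<phi>) = ShO T ` Pm"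
    using assms(4) by (auto simp: Pm_def)
  then have ge_eq: "ext_hull T (\<Union>\<phi>\<in>\<tau> ` \<Phi>m. \<P> \<phi>) = ShO T ` E"
    by (simp add: ext_hull_shift[OF Pm] E_def)
  have unshift_ge: "shift_ob T (- 1) ` ShO T ` E = E"
  proof -
    have "shift_ob T (- 1) (ShO T A) = A" if "A \<in> E" for A
      using that ext_class_obj[OF E] by (auto simp: shift_ob_simps)
    then show ?thesis
      by (force simp: image_image)
  qed

  have \<tau>_up: "\<tau> \<phi> \<in> \<Phi>p" if "\<phi> \<in> \<Phi>p" for \<phi>
  proof -
    have "\<tau> \<phi> \<in> \<Phi>" "\<phi> \<le> \<tau> \<phi>"
      using aut that assms(4) by (auto simp: bij_betw_def)
    then show ?thesis
      using assms(4,6) that by (metis UnE leD)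
  qed
  have \<tau>_down: "\<Phi>m \<subseteq> \<tau> ` \<Phi>m"
  proof
    fix \<phi> assume \<phi>: "\<phi> \<in> \<Phi>m"
    then obtain \<psi> where "\<psi> \<in> \<Phi>" "\<phi> = \<tau> \<psi>"
      using aut assms(4) unfolding bij_betw_def by blast
    moreover from this have "\<psi> \<notin> \<Phi>p"
      using \<tau>_up \<phi> assms(5) by blast
    ultimately show "\<phi> \<in> \<tau> ` \<Phi>m"
      using assms(4) by blast
  qed

  have D_shift: "D \<subseteq> shift_ob T (- 1) ` D"
  proof
    fix X assume X: "X \<in> D"
    have "ShO T X \<in> Pp" if "X \<in> Pp" for X
      using that \<tau>_up shift_P assms(4) unfolding Pp_def by blast
    then have "D \<subseteq> {X \<in> Obj T. ShO T X \<in> D}"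
      unfolding D_def using Pp ext_hull_superset[of Pp T]
      by (intro ext_hull_least ext_class_unshift ext_class_ext_hull) auto
    then show "X \<in> shift_ob T (- 1) ` D"
      using X shift_ob_simps(3)[of X] by (metis (no_types, lifting) image_eqI mem_Collect_eq subsetD)
  qed

  have E_shift: "E \<subseteq> ShO T ` E"
  proof -
    have "Pm \<subseteq> ShO T ` Pm"
      using \<tau>_down shift_P assms(4) unfolding Pm_def by blast
    then have "Pm \<subseteq> ShO T ` E"
      using ext_hull_superset[of Pm T] by (auto simp: E_def)
    then show ?thesis
      unfolding E_def by (intro ext_hull_least ext_class_shift E[unfolded E_def])
  qed

  have orth: "Hom_vanish T 0 D E"
  proof -
    have "Homs T X Y = {Zero T X Y}" if XY: "X \<in> Pp" "Y \<in> Pm" for X Y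
    proof -
      obtain \<phi> \<psi> where "\<phi> \<in> \<Phi>m" "Y \<in> \<P> \<phi>" "\<psi> \<in> \<Phi>p" "X \<in> \<P> \<psi>"
        using XY by (auto simp: Pp_def Pm_def)
      moreover from this have "Hom_vanish T 0 (\<P> \<psi>) (\<P> \<phi>)"
        using stab assms(4,6) by auto
      ultimately show ?thesis
        by (auto simp: Hom_vanish_def shift_ob_simps)
    qed
    then show ?thesis
      using Hom_zero_ext_hull[OF Pp Pm] by (simp add: Hom_vanish_def shift_ob_simps D_def E_def)
  qed

  have dec: "decomposable D E X" if X: "X \<in> Obj T" for X
  proof (cases "zero_object T X")
    case True
    then show ?thesis
      using decomposable_left[OF D E] D by (auto simp: ext_class_def)
  next
    case False
    then obtain n F G \<phi> where F0: "F 0 = X" and end_zero: "zero_object T (F (Suc n))"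
      and fil: "\<forall>i \<le> n. \<phi> i \<in> \<Phi> \<and> G i \<in> \<P> (\<phi> i) \<and> \<not> zero_object T (G i) \<and>
                  (\<exists>u v w. dist_triangle T (F (Suc i)) (F i) (G i) u v w)"
      and incr: "\<forall>i < n. \<phi> i < \<phi> (Suc i)"
      using stab X by blast
    have "decomposable D E (F 0)"
    proof (rule decomposable_filtration[OF D E, where F = F and n = n and
          up = "\<lambda>i. \<phi> i \<in> \<Phi>p", OF end_zero])
      show "G i \<in> D" if "i \<le> n" "\<phi> i \<in> \<Phi>p" for i
        using that fil ext_hull_superset[of Pp T] by (auto simp: D_def Pp_def)
      show "G i \<in> E" if "i \<le> n" "\<phi> i \<notin> \<Phi>p" for i
        using that fil assms(4) ext_hull_superset[of Pm T] by (auto simp: E_def Pm_def)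
      show "\<phi> (Suc i) \<in> \<Phi>p" if "i < n" "\<phi> i \<in> \<Phi>p" for i
      proof -
        have "\<phi> (Suc i) \<in> \<Phi>" "\<phi> i < \<phi> (Suc i)"
          using that fil incr by auto
        then show ?thesis
          using that assms(4,6) by (metis UnE less_asym)
      qed
    qed (use fil in auto)
    then show ?thesis
      by (simp add: F0)
  qed

  have "t_structure T D (ShO T ` E)"
    unfolding t_structure_def unshift_ge
    using D ext_class_shift[OF E] D_shift E_shift orth dec
    by (auto simp: ext_class_def decomposable_def)
  then show ?thesis
    unfolding ge_eq D_def Pp_def .
qed

end
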